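(* Let $\mathsf{k}$ be a field and let $m\xrightarrow{A}d\xleftarrow{B}n$ be a corelation in $\mathsf{Corel}\,\mathsf{Mat}\,\mathsf{k}[s,s^{-1}]$. Then the LTI behaviour $\Phi(\xrightarrow{A}\xleftarrow{B})$ is controllable if and only if there exist $e\in\mathbb N$ and matrices $R\colon e\to m$, $S\colon e\to n$ over $\mathsf{k}[s,s^{-1}]$ such that $$m\xleftarrow{R}e\xrightarrow{S}n\;=\;m\xrightarrow{A}d\xleftarrow{B}n$$ as morphisms in $\mathsf{Corel}\,\mathsf{Mat}\,\mathsf{k}[s,s^{-1}]$.
   Context: $\mathsf{k}$ is a field. $\mathsf{Mat}\,\mathsf{k}[s,s^{-1}]$ is the category with objects natural numbers and arrows $m\to n$ the $n\times m$ matrices over $\mathsf{k}[s,s^{-1}]$, composition being matrix multiplication. In it every morphism factors as an epi followed by a split mono. The category (prop) $\mathsf{Corel}\,\mathsf{Mat}\,\mathsf{k}[s,s^{-1}]$ has as morphisms $m\to n$ isomorphism classes of cospans $m\xrightarrow{A}d\xleftarrow{B}n$ (corelations) with $[A\ B]\colon m+n\to d$ an epimorphism in $\mathsf{Mat}\,\mathsf{k}[s,s^{-1}]$. Composition is by pushout in $\mathsf{Mat}\,\mathsf{k}[s,s^{-1}]$ followed by replacing the resulting cospan by the epi part of the epi–split mono factorisation of its copairing. A span $m\xleftarrow{R}e\xrightarrow{S}n$ is regarded as a morphism of $\mathsf{Corel}\,\mathsf{Mat}\,\mathsf{k}[s,s^{-1}]$ as the composite of $m\xrightarrow{\mathrm{id}}m\xleftarrow{R}e$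 followed by $e\xrightarrow{S}n\xleftarrow{\mathrm{id}}n$. The ring $\mathsf{k}[s,s^{-1}]$ acts on $\mathsf{k}^{\mathbb Z}$ by $(s\cdot w)(t)=w(t-1)$, $(s^{-1}\cdot w)(t)=w(t+1)$, and $\theta M\colon(\mathsf{k}^m)^{\mathbb Z}\to(\mathsf{k}^n)^{\mathbb Z}$ denotes the linear map induced by an $n\times m$ matrix $M$. The map $\Phi$ sends a corelation $m\xrightarrow{A}d\xleftarrow{B}n$ to the behaviour $\{(\mathbf x,\mathbf y)\mid(\theta A)\mathbf x=(\theta B)\mathbf y\}\subseteq(\mathsf{k}^m)^{\mathbb Z}\oplus(\mathsf{k}^n)^{\mathbb Z}\cong(\mathsf{k}^{m}\oplus \mathsf{k}^n)^{\mathbb Z}$. A behaviour $\mathscr B\subseteq W^{\mathbb Z}$ is controllable if for all $w,w'\in\mathscr B$ and all $t_0\in\mathbb Z$ there exist $w''\in\mathscr B$ and $t_0'\in\mathbb Z$ with $t_0'>t_0$ such that $w''(t)=w(t)$ for $t\le t_0$ and $w''(t)=w'(t-t_0')$ for $t\ge t_0'$. *)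

theory Defs
  imports
    "HOL-Library.Poly_Mapping"
    "Jordan_Normal_Form.Matrix"
begin

section \<open>The category of matrices over a commutative ring\<close>

text \<open>Objects are natural numbers; an arrow from \<open>m\<close> to \<open>n\<close> is an \<open>n \<times> m\<close> matrix, and the
  composite of \<open>M : m \<rightarrow> n\<close> followed by \<open>N : n \<rightarrow> p\<close> is the matrix product \<open>N * M\<close>.
  Note the swap of the dimensions in \<open>mat_hom\<close>.\<close>

abbreviation mat_hom :: "nat \<Rightarrow> nat \<Rightarrow> 'a mat set" where
  "mat_hom m n \<equiv> carrier_mat n m"

definition mat_epi :: "nat \<Rightarrow> nat \<Rightarrow> 'a::comm_ring_1 mat \<Rightarrow> bool" where
  "mat_epi m n E \<longleftrightarrow> E \<in> mat_hom m n \<and>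
     (\<forall>p. \<forall>X\<in>mat_hom n p. \<forall>Y\<in>mat_hom n p. X * E = Y * E \<longrightarrow> X = Y)"

definition mat_split_mono :: "nat \<Rightarrow> nat \<Rightarrow> 'a::comm_ring_1 mat \<Rightarrow> bool" where
  "mat_split_mono m n M \<longleftrightarrow> M \<in> mat_hom m n \<and> (\<exists>L\<in>mat_hom n m. L * M = 1\<^sub>m m)"

definition mat_iso :: "nat \<Rightarrow> nat \<Rightarrow> 'a::comm_ring_1 mat \<Rightarrow> bool" where
  "mat_iso m n U \<longleftrightarrow> U \<in> mat_hom m n \<and>
     (\<exists>V\<in>mat_hom n m. V * U = 1\<^sub>m m \<and> U * V = 1\<^sub>m n)"

text \<open>\<open>mat_pushout e m n R S q P Q\<close>: the cospan \<open>P : m \<rightarrow> q \<leftarrow> n : Q\<close> is a pushout of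
  the span \<open>R : m \<leftarrow> e \<rightarrow> n : S\<close>.\<close>

definition mat_pushout ::
  "nat \<Rightarrow> nat \<Rightarrow> nat \<Rightarrow> 'a::comm_ring_1 mat \<Rightarrow> 'a mat \<Rightarrow> nat \<Rightarrow> 'a mat \<Rightarrow> 'a mat \<Rightarrow> bool" where
  "mat_pushout e m n R S q P Q \<longleftrightarrow>
     R \<in> mat_hom e m \<and> S \<in> mat_hom e n \<and> P \<in> mat_hom m q \<and> Q \<in> mat_hom n q \<and>
     P * R = Q * S \<and>
     (\<forall>p. \<forall>X\<in>mat_hom m p. \<forall>Y\<in>mat_hom n p. X * R = Y * S \<longrightarrow>
        (\<exists>!U. U \<in> mat_hom q p \<and> U * P = X \<and> U * Q = Y))"

text \<open>The copairing of \<open>A : m \<rightarrow> d\<close> and \<open>B : n \<rightarrow> d\<close> is the block matrix \<open>[A B] : m + n \<rightarrow> d\<close>.\<close>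

definition copairing :: "'a::zero mat \<Rightarrow> 'a mat \<Rightarrow> 'a mat" where
  "copairing A B = four_block_mat A B (0\<^sub>m 0 (dim_col A)) (0\<^sub>m 0 (dim_col B))"


section \<open>Corelations\<close>

definition corelation ::
  "nat \<Rightarrow> nat \<Rightarrow> nat \<Rightarrow> 'a::comm_ring_1 mat \<Rightarrow> 'a mat \<Rightarrow> bool" where
  "corelation m d n A B \<longleftrightarrow>
     A \<in> mat_hom m d \<and> B \<in> mat_hom n d \<and> mat_epi (m + n) d (copairing A B)"

definition corel_iso ::
  "nat \<Rightarrow> nat \<Rightarrow> (('a::comm_ring_1 mat \<times> 'a mat) \<times> ('a mat \<times> 'a mat)) set" where
  "corel_iso m n = {((A, B), (A', B')). \<exists>d d' U.
     corelation m d n A B \<and> corelation m d' n A' B' \<and>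
     mat_iso d d' U \<and> U * A = A' \<and> U * B = B'}"

text \<open>The morphism \<open>m \<rightarrow> n\<close> of the category of corelations represented by the
  cospan \<open>A : m \<rightarrow> d \<leftarrow> n : B\<close>. Morphisms are isomorphism classes, so equality of morphisms is
  equality of these sets.\<close>

definition corel_class ::
  "nat \<Rightarrow> nat \<Rightarrow> 'a::comm_ring_1 mat \<Rightarrow> 'a mat \<Rightarrow> ('a mat \<times> 'a mat) set" where
  "corel_class m n A B = corel_iso m n `` {(A, B)}"

text \<open>Composition of \<open>F : m \<rightarrow> n\<close> followed by \<open>G : n \<rightarrow> p\<close>. All choices of representatives, of a
  pushout \<open>(P, Q)\<close> and of an epi--split mono factorisation \<open>N * [A' B']\<close> of the copairing of the
  resulting cospan are admitted: they lead to isomorphic corelations, and collecting all results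
  yields the whole isomorphism class.\<close>

definition corel_comp ::
  "nat \<Rightarrow> nat \<Rightarrow> nat \<Rightarrow> ('a::comm_ring_1 mat \<times> 'a mat) set \<Rightarrow> ('a mat \<times> 'a mat) set
     \<Rightarrow> ('a mat \<times> 'a mat) set" where
  "corel_comp m n p F G = {(A', B'). \<exists>A B C D d d' q P Q c N.
     (A, B) \<in> F \<and> A \<in> mat_hom m d \<and> B \<in> mat_hom n d \<and>
     (C, D) \<in> G \<and> C \<in> mat_hom n d' \<and> D \<in> mat_hom p d' \<and>
     mat_pushout n d d' B C q P Q \<and>
     A' \<in> mat_hom m c \<and> B' \<in> mat_hom p c \<and>
     mat_epi (m + p) c (copairing A' B') \<and> mat_split_mono c q N \<and>
     copairing (P * A) (Q * D) = N * copairing A' B'}"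

definition span_corel ::
  "nat \<Rightarrow> nat \<Rightarrow> nat \<Rightarrow> 'a::comm_ring_1 mat \<Rightarrow> 'a mat \<Rightarrow> ('a mat \<times> 'a mat) set" where
  "span_corel m e n R S =
     corel_comp m e n (corel_class m e (1\<^sub>m m) R) (corel_class e n S (1\<^sub>m n))"


section \<open>Laurent polynomials and behaviours\<close>

text \<open>\<open>k[s, s\<^sup>-\<^sup>1]\<close> as the group algebra of the integers over \<open>k\<close>: finitely supported functions
  with convolution product, \<open>Poly_Mapping.single i c\<close> being the monomial \<open>c s\<^sup>i\<close>.\<close>

type_synonym 'k laurent_poly = "int \<Rightarrow>\<^sub>0 'k"

definition laurent_act :: "'k::field laurent_poly \<Rightarrow> (int \<Rightarrow> 'k) \<Rightarrow> int \<Rightarrow> 'k" where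
  "laurent_act p w t = (\<Sum>i\<in>Poly_Mapping.keys p. Poly_Mapping.lookup p i * w (t - i))"

definition trajectories :: "nat \<Rightarrow> (int \<Rightarrow> 'k vec) set" where
  "trajectories n = {w. \<forall>t. w t \<in> carrier_vec n}"

definition theta :: "'k::field laurent_poly mat \<Rightarrow> (int \<Rightarrow> 'k vec) \<Rightarrow> int \<Rightarrow> 'k vec" where
  "theta M x t =
     vec (dim_row M) (\<lambda>i. \<Sum>j<dim_col M. laurent_act (M $$ (i, j)) (\<lambda>u. x u $ j) t)"

text \<open>Pairs of trajectories are read as trajectories in \<open>k\<^sup>m \<oplus> k\<^sup>n = k\<^sup>m\<^sup>+\<^sup>n\<close>.\<close>

definition behaviour ::
  "nat \<Rightarrow> nat \<Rightarrow> 'k::field laurent_poly mat \<Rightarrow> 'k laurent_poly mat \<Rightarrow> (int \<Rightarrow> 'k vec) set" where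
  "behaviour m n A B = {\<lambda>t. x t @\<^sub>v y t | x y.
     x \<in> trajectories m \<and> y \<in> trajectories n \<and> theta A x = theta B y}"

definition controllable :: "(int \<Rightarrow> 'w) set \<Rightarrow> bool" where
  "controllable \<B> \<longleftrightarrow> (\<forall>w\<in>\<B>. \<forall>w'\<in>\<B>. \<forall>t\<^sub>0. \<exists>w''\<in>\<B>. \<exists>t\<^sub>0'. t\<^sub>0' > t\<^sub>0 \<and>
     (\<forall>t\<le>t\<^sub>0. w'' t = w t) \<and> (\<forall>t\<ge>t\<^sub>0'. w'' t = w' (t - t\<^sub>0')))"


section \<open>Basic facts\<close>

lemma laurent_act_single: "laurent_act (Poly_Mapping.single i c) w t = c * w (t - i)"
  by (cases "c = 0") (simp_all add: laurent_act_def)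

lemma corelation_dim: "corelation m d n A B \<Longrightarrow> d = dim_row A"
  by (auto simp: corelation_def)

lemma equiv_corel_iso:
  "equiv {(A, B). \<exists>d. corelation m d n A B} (corel_iso m n :: (('a::comm_ring_1 mat \<times> 'a mat) \<times> _) set)"
proof (rule equivI)
  show "(corel_iso m n :: (('a mat \<times> 'a mat) \<times> _) set) \<subseteq> {(A, B). \<exists>d. corelation m d n A B} \<times> {(A, B). \<exists>d. corelation m d n A B}"
    by (auto simp: corel_iso_def)
  show "refl_on {(A, B). \<exists>d. corelation m d n A B} (corel_iso m n :: (('a mat \<times> 'a mat) \<times> _) set)"
  proof (rule refl_onI, clarify)
    fix A B :: "'a mat" and d assume c: "corelation m d n A B"
    have "mat_iso d d (1\<^sub>m d :: 'a mat)"
      by (auto simp: mat_iso_def intro!: bexI[of _ "1\<^sub>m d"])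
    moreover have "1\<^sub>m d * A = A" "1\<^sub>m d * B = B"
      using c by (auto simp: corelation_def)
    ultimately show "((A, B), (A, B)) \<in> corel_iso m n"
      using c unfolding corel_iso_def by blast
  qed
  show "sym (corel_iso m n :: (('a mat \<times> 'a mat) \<times> _) set)"
  proof (rule symI, clarify)
    fix A B A' B' :: "'a mat" assume "((A, B), (A', B')) \<in> corel_iso m n"
    then obtain d d' U V where c: "corelation m d n A B" "corelation m d' n A' B'"
      and U: "U \<in> mat_hom d d'" "V \<in> mat_hom d' d" "V * U = 1\<^sub>m d" "U * V = 1\<^sub>m d'"
      and eq: "U * A = A'" "U * B = B'"
      by (auto simp: corel_iso_def mat_iso_def)
    have AB: "A \<in> mat_hom m d" "B \<in> mat_hom n d"
      using c by (auto simp: corelation_def)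
    have "V * A' = A" "V * B' = B"
      using U AB eq assoc_mult_mat[of V d d' U d A m] assoc_mult_mat[of V d d' U d B n] by auto
    moreover have "mat_iso d' d V" using U by (auto simp: mat_iso_def)
    ultimately show "((A', B'), (A, B)) \<in> corel_iso m n"
      using c unfolding corel_iso_def by blast
  qed
  show "trans (corel_iso m n :: (('a mat \<times> 'a mat) \<times> _) set)"
  proof (rule transI, clarify)
    fix A B A1 B1 A2 B2 :: "'a mat"
    assume "((A, B), (A1, B1)) \<in> corel_iso m n" "((A1, B1), (A2, B2)) \<in> corel_iso m n"
    then obtain d d1 d1' d2 U W V X where c: "corelation m d n A B" "corelation m d1 n A1 B1"
        "corelation m d1' n A1 B1" "corelation m d2 n A2 B2"
      and U: "U \<in> mat_hom d d1" "V \<in> mat_hom d1 d" "V * U = 1\<^sub>m d" "U * V = 1\<^sub>m d1"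
      and W: "W \<in> mat_hom d1' d2" "X \<in> mat_hom d2 d1'" "X * W = 1\<^sub>m d1'" "W * X = 1\<^sub>m d2"
      and eq: "U * A = A1" "U * B = B1" "W * A1 = A2" "W * B1 = B2"
      unfolding corel_iso_def mat_iso_def by blast
    have [simp]: "d1' = d1" using c(2,3) by (auto dest: corelation_dim)
    have AB: "A \<in> mat_hom m d" "B \<in> mat_hom n d"
      using c by (auto simp: corelation_def)
    note W = W[simplified]
    have "(V * X) * (W * U) = V * ((X * W) * U)"
      using U(1,2) W(1,2) assoc_mult_mat[of V d d1 X d2 "W * U" d] assoc_mult_mat[of X d1 d2 W d1 U d]
      by simp
    also have "\<dots> = 1\<^sub>m d" using U W by simp
    finally have 1: "(V * X) * (W * U) = 1\<^sub>m d" .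
    have "(W * U) * (V * X) = W * ((U * V) * X)"
      using U(1,2) W(1,2) assoc_mult_mat[of W d2 d1 U d "V * X" d2] assoc_mult_mat[of U d1 d V d1 X d2]
      by simp
    also have "\<dots> = 1\<^sub>m d2" using U W by simp
    finally have 2: "(W * U) * (V * X) = 1\<^sub>m d2" .
    have "mat_iso d d2 (W * U)"
      unfolding mat_iso_def
      using 1 2 mult_carrier_mat[OF W(1) U(1)] mult_carrier_mat[OF U(2) W(2)] by blast
    moreover have "W * U * A = A2" "W * U * B = B2"
      using U(1) W(1) AB eq assoc_mult_mat[of W d2 d1 U d A m] assoc_mult_mat[of W d2 d1 U d B n]
      by auto
    ultimately show "((A, B), (A2, B2)) \<in> corel_iso m n"
      using c unfolding corel_iso_def by blast
  qed
qed

end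

(*
  Put M = [A, -B], so that the behaviour is the kernel of theta M on trajectories, and M has
  trivial left kernel because [A, B] is epi. Trajectories in (k^N)^Z are the k-linear functionals on
  row vectors over k[s, 1/s], via w_j(t) = f(s^(-t) e_j); hence extension of functionals turns
  exactness statements about rows into exactness statements about trajectories.

  The span (R, S) represents the corelation (A, B) iff (A, B) is its pushout, i.e. iff the rows of M
  form the left kernel of the stacked matrix K = [R; S]. In that case the kernel of theta M is the
  image of theta K, and trajectories in an image can be patched together.

  Conversely, let M L = delta 1 with delta nonzero. If the behaviour is controllable and delta Z is
  a combination of the rows of M, then Z annihilates the behaviour: patch w with 0; Z applied to the
  result is annihilated by delta and eventually zero, hence zero. So Z lies in the row space of M,
  and this says exactly that M is the left kernel of K = delta 1 - L M. No normal form of matrices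
  over k[s, 1/s] is needed.
*)
theory Submission
  imports Defs "HOL-Library.Function_Algebras"
begin

section \<open>The action of Laurent polynomials on sequences\<close>

lemma sum_fun_apply: "(\<Sum>x\<in>A. f x) y = (\<Sum>x\<in>A. f x y)"
  for f :: "'a \<Rightarrow> 'b \<Rightarrow> 'c::comm_monoid_add"
  by (induction A rule: infinite_finite_induct) auto

text \<open>Lets polynomials with different supports be summed over one common index set.\<close>

lemma laurent_act_superset:
  assumes "finite S" "Poly_Mapping.keys p \<subseteq> S"
  shows "laurent_act p w t = (\<Sum>i\<in>S. Poly_Mapping.lookup p i * w (t - i))"
  unfolding laurent_act_def
  by (rule sum.mono_neutral_left) (use assms in \<open>auto simp: in_keys_iff\<close>)

lemma laurent_act_add: "laurent_act (p + q) w = laurent_act p w + laurent_act q w"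
proof
  fix t
  let ?S = "Poly_Mapping.keys p \<union> Poly_Mapping.keys q"
  show "laurent_act (p + q) w t = (laurent_act p w + laurent_act q w) t"
    using laurent_act_superset[of ?S "p + q" w t] laurent_act_superset[of ?S p w t]
      laurent_act_superset[of ?S q w t] Poly_Mapping.keys_add[of p q]
    by (simp add: lookup_add distrib_right sum.distrib)
qed

lemma laurent_act_0 [simp]: "laurent_act 0 w = 0"
  by (simp add: laurent_act_def fun_eq_iff)

lemma laurent_act_sum: "laurent_act (\<Sum>x\<in>X. p x) w = (\<Sum>x\<in>X. laurent_act (p x) w)"
  by (induction X rule: infinite_finite_induct) (auto simp: laurent_act_add)

lemma laurent_act_uminus: "laurent_act (- p) w t = - laurent_act p w t"
  by (simp add: laurent_act_def sum_negf)

lemma laurent_act_zero_right [simp]: "laurent_act p (\<lambda>_. 0) = (\<lambda>_. 0)"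
  by (simp add: laurent_act_def fun_eq_iff)

lemma laurent_act_sum_right:
  "laurent_act p (\<lambda>u. \<Sum>x\<in>X. w x u) t = (\<Sum>x\<in>X. laurent_act p (w x) t)"
  unfolding laurent_act_def sum_distrib_left by (rule sum.swap)

lemma poly_mapping_sum_single:
  "p = (\<Sum>i\<in>Poly_Mapping.keys p. Poly_Mapping.single i (Poly_Mapping.lookup p i))"
proof (rule poly_mapping_eqI)
  fix k
  show "Poly_Mapping.lookup p k = Poly_Mapping.lookup (\<Sum>i\<in>Poly_Mapping.keys p. Poly_Mapping.single i (Poly_Mapping.lookup p i)) k"
    by (auto simp: lookup_sum lookup_single when_def in_keys_iff)
qed

lemma laurent_act_single_mult:
  "laurent_act (Poly_Mapping.single i c * p) w t = c * laurent_act p w (t - i)"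
proof -
  have "Poly_Mapping.single i c * p =
      (\<Sum>j\<in>Poly_Mapping.keys p. Poly_Mapping.single (i + j) (c * Poly_Mapping.lookup p j))"
    by (subst (1) poly_mapping_sum_single[of p]) (simp add: sum_distrib_left mult_single)
  then show ?thesis
    by (simp add: laurent_act_sum sum_fun_apply laurent_act_single laurent_act_def[of p] sum_distrib_left
        mult.assoc diff_diff_eq)
qed

lemma laurent_act_mult: "laurent_act (p * q) w = laurent_act p (laurent_act q w)"
proof -
  have "p * q = (\<Sum>i\<in>Poly_Mapping.keys p. Poly_Mapping.single i (Poly_Mapping.lookup p i) * q)"
    by (subst (1) poly_mapping_sum_single[of p]) (simp add: sum_distrib_right)
  then show ?thesis
    by (simp add: laurent_act_sum laurent_act_single_mult fun_eq_iff sum_fun_apply laurent_act_def[of p])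
qed

text \<open>Were \<open>v\<close> nonzero, let \<open>u\<close> be its last nonzero index and
  \<open>i\<close> the top exponent of \<open>p\<close>. The value of the action at
  \<open>u + i\<close> is then the single term \<open>lookup p i * v u\<close>, which is nonzero
  over a field.\<close>

lemma laurent_act_eq_0_imp:
  assumes p: "p \<noteq> 0" and pv: "laurent_act p v = 0" and T: "\<And>t. t \<ge> T \<Longrightarrow> v t = 0"
  shows "v = 0"
proof (rule ccontr)
  assume "v \<noteq> 0"
  then obtain t0 where t0: "v t0 \<noteq> 0" by (auto simp: fun_eq_iff)
  \<comment> \<open>\<open>v\<close> may be nonzero infinitely often in the past; the part from
    \<open>t0\<close> on is finite, which suffices for a last nonzero index.\<close>
  let ?S = "{t. t0 \<le> t \<and> v t \<noteq> 0}"
  have "t \<le> T" if "v t \<noteq> 0" for t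
    using T[of t] that by linarith
  then have "?S \<subseteq> {t0..T}" by auto
  then have fin: "finite ?S" by (rule finite_subset) (rule finite_atLeastAtMost_int)
  define u where "u = Max ?S"
  have u: "v u \<noteq> 0" "t0 \<le> u" using Max_in[OF fin] t0 by (auto simp: u_def)
  have gr: "v t = 0" if "t > u" for t
    using Max_ge[OF fin, of t] that u(2) by (force simp: u_def)
  define i where "i = Max (Poly_Mapping.keys p)"
  have i: "i \<in> Poly_Mapping.keys p" using p by (simp add: i_def)
  have "laurent_act p v (u + i) = (\<Sum>k\<in>{i}. Poly_Mapping.lookup p k * v (u + i - k))"
    unfolding laurent_act_def
  proof (rule sum.mono_neutral_right)
    show "\<forall>k\<in>Poly_Mapping.keys p - {i}. Poly_Mapping.lookup p k * v (u + i - k) = 0"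
    proof
      fix k assume k: "k \<in> Poly_Mapping.keys p - {i}"
      then have "k \<le> i" by (simp add: i_def)
      with k show "Poly_Mapping.lookup p k * v (u + i - k) = 0" by (simp add: gr)
    qed
  qed (use i in auto)
  then show False using pv u i by (simp add: in_keys_iff)
qed

section \<open>Trajectories as functionals on row vectors\<close>

text \<open>Rows form a vector space over the field, where bases exist and functionals extend; this
  fails over the Laurent ring. They are indexed by all of \<open>nat\<close> so that the space is a
  whole type, and a width \<open>N\<close> is imposed by truncation.\<close>

definition row_scale :: "'k::field \<Rightarrow> (nat \<Rightarrow> 'k laurent_poly) \<Rightarrow> nat \<Rightarrow> 'k laurent_poly" where
  "row_scale c X = (\<lambda>j. Poly_Mapping.single 0 c * X j)"

interpretation rows: vector_space "row_scale :: 'k::field \<Rightarrow> _"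
  by unfold_locales
    (auto simp: row_scale_def fun_eq_iff single_add mult_single distrib_left distrib_right
      mult.assoc[symmetric])

interpretation row_maps: vector_space_pair "row_scale :: 'k::field \<Rightarrow> _" "row_scale :: 'k::field \<Rightarrow> _"
  by unfold_locales

interpretation scalars: vector_space "(*) :: 'k::field \<Rightarrow> _"
  by unfold_locales (auto simp: algebra_simps)

interpretation functionals: vector_space_pair "row_scale :: 'k::field \<Rightarrow> _" "(*) :: 'k::field \<Rightarrow> _"
  by unfold_locales

definition unit_row :: "nat \<Rightarrow> 'k::field laurent_poly \<Rightarrow> nat \<Rightarrow> 'k laurent_poly" where
  "unit_row j p = (\<lambda>i. if i = j then p else 0)"

text \<open>The sign in the exponent makes the value at \<open>t - 1\<close> equal to
  \<open>f\<close> applied to \<open>s\<close> times the row used at \<open>t\<close>, so the shift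
  of trajectories matches multiplication of rows by \<open>s\<close>.\<close>

definition dual_traj :: "((nat \<Rightarrow> 'k::field laurent_poly) \<Rightarrow> 'k) \<Rightarrow> nat \<Rightarrow> int \<Rightarrow> 'k" where
  "dual_traj f j t = f (unit_row j (Poly_Mapping.single (- t) 1))"

lemma unit_row_sum: "unit_row j (\<Sum>x\<in>A. p x) = (\<Sum>x\<in>A. unit_row j (p x))"
  by (simp add: unit_row_def fun_eq_iff sum_fun_apply)

text \<open>Expanding the entries of \<open>X\<close> into monomials and using linearity over the
  field turns the action of a row on a dual trajectory into one evaluation of
  \<open>f\<close>.\<close>

lemma dual_traj_eq:
  assumes f: "Vector_Spaces.linear row_scale (*) f"
  shows "(\<Sum>j<N. laurent_act (X j) (dual_traj f j) t) =
    f (\<lambda>j. if j < N then Poly_Mapping.single (- t) 1 * X j else 0)"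
proof -
  interpret f: Vector_Spaces.linear row_scale "(*)" f by (rule f)
  have 1: "laurent_act p (dual_traj f j) t = f (unit_row j (Poly_Mapping.single (- t) 1 * p))" for p j
  proof -
    have "unit_row j (Poly_Mapping.single (- t) 1 * p) =
        (\<Sum>i\<in>Poly_Mapping.keys p. unit_row j (Poly_Mapping.single (i - t) (Poly_Mapping.lookup p i)))"
      by (subst (1) poly_mapping_sum_single[of p]) (simp add: sum_distrib_left mult_single unit_row_sum)
    also have "\<dots> = (\<Sum>i\<in>Poly_Mapping.keys p. row_scale (Poly_Mapping.lookup p i)
        (unit_row j (Poly_Mapping.single (i - t) 1)))"
      by (rule sum.cong) (auto simp: row_scale_def unit_row_def mult_single fun_eq_iff)
    finally show ?thesis
      by (simp add: f.sum f.scale laurent_act_def dual_traj_def)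
  qed
  have "(\<lambda>j. if j < N then Poly_Mapping.single (- t) 1 * X j else 0) =
      (\<Sum>j<N. unit_row j (Poly_Mapping.single (- t) 1 * X j))"
    by (simp add: fun_eq_iff unit_row_def sum_fun_apply)
  then show ?thesis by (simp add: 1 f.sum)
qed

text \<open>Some functional vanishes on the row module of \<open>M\<close> and takes the value 1 at
  a row \<open>Z\<close> outside it. Its dual trajectory satisfies the equations of \<open>M\<close>
  at all times, but not that of \<open>Z\<close> at time 0.\<close>

lemma row_space_separation:
  fixes M :: "nat \<Rightarrow> nat \<Rightarrow> 'k::field laurent_poly"
  assumes Z: "\<And>c. \<exists>j<N. Z j \<noteq> (\<Sum>i<d. c i * M i j)"
  shows "\<exists>w. (\<forall>i<d. \<forall>t. (\<Sum>j<N. laurent_act (M i j) (w j) t) = 0) \<and>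
    (\<exists>t. (\<Sum>j<N. laurent_act (Z j) (w j) t) \<noteq> 0)"
proof -
  define comb where "comb c j = (if j < N then \<Sum>i<d. c i * M i j else 0)" for c :: "nat \<Rightarrow> 'k laurent_poly" and j
  define S where "S = range comb"
  define Z' where "Z' j = (if j < N then Z j else 0)" for j
  have sub: "rows.subspace S"
  proof (rule rows.subspaceI)
    have "comb (\<lambda>_. 0) = 0" by (simp add: comb_def fun_eq_iff)
    then show "0 \<in> S" unfolding S_def by (metis rangeI)
  next
    fix X Y assume "X \<in> S" "Y \<in> S"
    then obtain a b where "X = comb a" "Y = comb b" by (auto simp: S_def)
    then have "X + Y = comb (a + b)"
      by (simp add: comb_def fun_eq_iff distrib_right sum.distrib)
    then show "X + Y \<in> S" by (simp add: S_def)
  next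
    fix a X assume "X \<in> S"
    then obtain b where "X = comb b" by (auto simp: S_def)
    then have "row_scale a X = comb (row_scale a b)"
      by (simp add: comb_def fun_eq_iff row_scale_def sum_distrib_left mult.assoc)
    then show "row_scale a X \<in> S" by (simp add: S_def)
  qed
  have "Z' \<notin> S"
  proof
    assume "Z' \<in> S"
    then obtain c where "Z' = comb c" by (auto simp: S_def)
    then have "Z j = (\<Sum>i<d. c i * M i j)" if "j < N" for j
      using that by (simp add: Z'_def comb_def fun_eq_iff) metis
    with Z[of c] show False by auto
  qed
  obtain B where B: "B \<subseteq> S" "rows.independent B" "S \<subseteq> rows.span B"
    by (rule rows.basis_exists)
  have "rows.span B \<subseteq> S" by (rule rows.span_minimal[OF B(1) sub])
  with \<open>Z' \<notin> S\<close> have Z'B: "Z' \<notin> rows.span B" by blast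
  then have "rows.independent (insert Z' B)"
    using B(2) by (simp add: rows.independent_insert)
  from functionals.linear_independent_extend[OF this, of "\<lambda>x. if x = Z' then 1 else 0"]
  obtain g where g: "Vector_Spaces.linear row_scale (*) g"
    and gZ: "g Z' = 1" and gB: "\<And>x. x \<in> B \<Longrightarrow> x \<noteq> Z' \<Longrightarrow> g x = 0"
    by auto
  have "g X = 0" if "X \<in> S" for X
  proof (rule functionals.linear_eq_0_on_span[OF g])
    show "g x = 0" if "x \<in> B" for x
      using gB[of x] that Z'B rows.span_base by metis
    show "X \<in> rows.span B" using that B(3) by blast
  qed
  \<comment> \<open>The module is closed under multiplication by powers of \<open>s\<close>, so a
    functional vanishing on it yields the equations at every time \<open>t\<close>.\<close>
  moreover have "(\<lambda>j. if j < N then Poly_Mapping.single (- t) 1 * M i j else 0) \<in> S" if "i < d" for i t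
  proof -
    have "comb (unit_row i (Poly_Mapping.single (- t) 1)) =
        (\<lambda>j. if j < N then Poly_Mapping.single (- t) 1 * M i j else 0)"
      using that by (simp add: comb_def unit_row_def fun_eq_iff if_distrib[of "\<lambda>x. x * _"] cong: if_cong)
    then show ?thesis unfolding S_def by (metis rangeI)
  qed
  ultimately have "\<forall>i<d. \<forall>t. (\<Sum>j<N. laurent_act (M i j) (dual_traj g j) t) = 0"
    by (simp add: dual_traj_eq[OF g])
  moreover have "(\<Sum>j<N. laurent_act (Z j) (dual_traj g j) 0) = 1"
    using gZ by (simp add: dual_traj_eq[OF g] Z'_def[abs_def] cong: if_cong)
  ultimately show ?thesis by (intro exI[of _ "dual_traj g"]) (auto intro!: exI[of _ 0])
qed

lemma laurent_act_linear:
  "Vector_Spaces.linear row_scale (*) (\<lambda>X. \<Sum>j<N. laurent_act (X j) (w j) (t::int))"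
  unfolding Vector_Spaces.linear_iff
  by (intro conjI rows.vector_space_axioms scalars.vector_space_axioms)
    (simp_all add: laurent_act_add sum.distrib row_scale_def laurent_act_single_mult sum_distrib_left)

text \<open>Evaluation of rows on \<open>w\<close> at time 0 vanishes on the rows killed by
  \<open>K\<close>, since these are combinations of rows of \<open>M\<close>. It therefore factors
  through multiplication by \<open>K\<close>, and the dual trajectory of the factor \<open>g\<close>
  is a preimage of \<open>w\<close>.\<close>

lemma kernel_representation_imp_image:
  fixes M K :: "nat \<Rightarrow> nat \<Rightarrow> 'k::field laurent_poly"
  assumes w: "\<And>i t. i < d \<Longrightarrow> (\<Sum>j<N. laurent_act (M i j) (w j) t) = 0"
    and K: "\<And>X. \<forall>l<e. (\<Sum>j<N. X j * K j l) = 0 \<Longrightarrow> \<exists>c. \<forall>j<N. X j = (\<Sum>i<d. c i * M i j)"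
  shows "\<exists>v. \<forall>j<N. \<forall>t. w j t = (\<Sum>l<e. laurent_act (K j l) (v l) t)"
proof -
  define T where "T X = (\<lambda>l. if l < e then \<Sum>j<N. X j * K j l else 0)" for X :: "nat \<Rightarrow> 'k laurent_poly"
  define f where "f X = (\<Sum>j<N. laurent_act (X j) (w j) 0)" for X
  have T: "Vector_Spaces.linear row_scale row_scale T"
    unfolding Vector_Spaces.linear_iff
    by (intro conjI rows.vector_space_axioms)
      (simp_all add: T_def fun_eq_iff distrib_right sum.distrib row_scale_def sum_distrib_left mult.assoc)
  have f: "Vector_Spaces.linear row_scale (*) f"
    unfolding f_def by (rule laurent_act_linear)
  interpret T: Vector_Spaces.linear row_scale row_scale T by (rule T)
  interpret f: Vector_Spaces.linear row_scale "(*)" f by (rule f)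
  have ker: "f X = 0" if "T X = 0" for X
  proof -
    have "(\<Sum>j<N. X j * K j l) = 0" if "l < e" for l
      using \<open>T X = 0\<close> that by (simp add: T_def fun_eq_iff) metis
    then obtain c where c: "\<And>j. j < N \<Longrightarrow> X j = (\<Sum>i<d. c i * M i j)"
      using K[of X] by auto
    have "f X = (\<Sum>j<N. \<Sum>i<d. laurent_act (c i) (laurent_act (M i j) (w j)) 0)"
      unfolding f_def
      by (rule sum.cong) (simp_all add: c laurent_act_sum sum_fun_apply laurent_act_mult)
    also have "\<dots> = (\<Sum>i<d. laurent_act (c i) (\<lambda>t. \<Sum>j<N. laurent_act (M i j) (w j) t) 0)"
      by (subst sum.swap) (simp add: laurent_act_sum_right)
    also have "\<dots> = 0" by (simp add: w)
    finally show ?thesis .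
  qed
  \<comment> \<open>\<open>h\<close> picks preimages linearly on the range of \<open>T\<close>;
    since \<open>f\<close> vanishes on the kernel of \<open>T\<close>, the choice does not affect
    the values of \<open>f\<close>.\<close>
  obtain h where h: "Vector_Spaces.linear row_scale row_scale h" "\<And>X. T (h (T X)) = T X"
    using row_maps.linear_exists_right_inverse_on[OF T rows.subspace_UNIV] by auto
  define g where "g = f \<circ> h"
  have g: "Vector_Spaces.linear row_scale (*) g"
    unfolding g_def by (rule Vector_Spaces.linear_compose[OF h(1) f])
  have gT: "g (T X) = f X" for X
  proof -
    have "T (h (T X) - X) = 0" by (simp add: T.diff h(2))
    from ker[OF this] show ?thesis by (simp add: f.diff g_def)
  qed
  have "w j t = (\<Sum>l<e. laurent_act (K j l) (dual_traj g l) t)" if "j < N" for j t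
  proof -
    \<comment> \<open>On this row \<open>f\<close> reads off \<open>w j t\<close>, while
      \<open>T\<close> sends it to row \<open>j\<close> of \<open>K\<close> times the same
      monomial.\<close>
    let ?X = "unit_row j (Poly_Mapping.single (- t) 1)"
    have "T ?X = (\<lambda>l. if l < e then Poly_Mapping.single (- t) 1 * K j l else 0)"
      using that by (simp add: T_def unit_row_def fun_eq_iff if_distrib[of "\<lambda>x. x * _"] cong: if_cong)
    moreover have "f ?X = (\<Sum>i<N. if i = j then w j t else 0)"
      unfolding f_def by (rule sum.cong) (auto simp: unit_row_def laurent_act_single)
    ultimately show ?thesis
      using that gT[of ?X] by (simp add: dual_traj_eq[OF g])
  qed
  then show ?thesis by blast
qed

section \<open>Kernels and images of Laurent polynomial matrices\<close>

text \<open>Over the fraction field independent rows have a right inverse; here it is built without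
  division, with \<open>\<delta>\<close> as a common denominator. The induction adjoins one row at a
  time, as in fraction-free Gaussian elimination.\<close>

lemma scaled_right_inverse_exists:
  fixes r :: "nat \<Rightarrow> nat \<Rightarrow> 'a::idom"
  assumes "\<And>c. \<forall>j<N. (\<Sum>i<d. c i * r i j) = 0 \<Longrightarrow> \<forall>i<d. c i = 0"
  shows "\<exists>\<delta> l. \<delta> \<noteq> 0 \<and> (\<forall>i<d. \<forall>i'<d. (\<Sum>j<N. r i j * l j i') = (if i = i' then \<delta> else 0))"
  using assms
proof (induction d)
  case 0
  show ?case by (rule exI[of _ 1]) simp
next
  case (Suc d)
  have "\<forall>i<d. c i = 0" if "\<forall>j<N. (\<Sum>i<d. c i * r i j) = 0" for c
  proof -
    have "\<forall>i<Suc d. (c(d := 0)) i = 0"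
      by (rule Suc.prems) (use that in simp)
    then show ?thesis by (metis fun_upd_other less_SucI less_irrefl)
  qed
  from Suc.IH[OF this] obtain \<delta> l where \<delta>: "\<delta> \<noteq> 0"
    and l: "\<And>i i'. i < d \<Longrightarrow> i' < d \<Longrightarrow> (\<Sum>j<N. r i j * l j i') = (if i = i' then \<delta> else 0)"
    by blast
  define a where "a i = (\<Sum>j<N. r d j * l j i)" for i
  \<comment> \<open>\<open>\<delta>\<close> times the new row, minus its component along the old
    rows; independence makes some entry nonzero.\<close>
  define r' where "r' j = \<delta> * r d j - (\<Sum>i<d. a i * r i j)" for j
  have "\<exists>q<N. r' q \<noteq> 0"
  proof (rule ccontr)
    assume "\<not> (\<exists>q<N. r' q \<noteq> 0)"
    then have "\<forall>j<N. (\<Sum>i<Suc d. (if i = d then \<delta> else - a i) * r i j) = 0"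
      by (simp add: r'_def sum_negf)
    from Suc.prems[OF this] \<delta> show False by auto
  qed
  then obtain q where q: "q < N" "r' q \<noteq> 0" by blast
  \<comment> \<open>\<open>\<delta>\<close> times the \<open>q\<close>-th unit column, corrected so
    that every old row annihilates it; the new row takes it to \<open>r' q\<close>.\<close>
  define c where "c j = (if j = q then \<delta> else 0) - (\<Sum>i<d. l j i * r i q)" for j
  have rc: "(\<Sum>j<N. x j * c j) = \<delta> * x q - (\<Sum>i<d. (\<Sum>j<N. x j * l j i) * r i q)" for x
  proof -
    have "(\<Sum>j<N. x j * c j) =
        (\<Sum>j<N. if j = q then \<delta> * x q else 0) - (\<Sum>j<N. \<Sum>i<d. x j * l j i * r i q)"
      unfolding sum_subtractf[symmetric]
      by (rule sum.cong) (auto simp: c_def algebra_simps sum_distrib_left)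
    moreover have "(\<Sum>j<N. \<Sum>i<d. x j * l j i * r i q) = (\<Sum>i<d. (\<Sum>j<N. x j * l j i) * r i q)"
      unfolding sum_distrib_right by (rule sum.swap)
    ultimately show ?thesis using q(1) by simp
  qed
  have c0: "(\<Sum>j<N. r i j * c j) = 0" if "i < d" for i
    using that by (simp add: rc l if_distrib[of "\<lambda>x. x * _"] cong: if_cong)
  have cd: "(\<Sum>j<N. r d j * c j) = r' q"
    by (simp add: rc r'_def a_def)
  \<comment> \<open>The old columns are scaled by \<open>r' q\<close> and corrected by multiples of
    \<open>c\<close> so that the new row annihilates them. With \<open>\<delta>\<close> times
    \<open>c\<close> as last column, all diagonal entries equal
    \<open>r' q * \<delta>\<close>.\<close>
  define l' where "l' j i = (if i < d then r' q * l j i - a i * c j else \<delta> * c j)" for j i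
  have 1: "(\<Sum>j<N. r i j * l' j i') = r' q * (\<Sum>j<N. r i j * l j i') - a i' * (\<Sum>j<N. r i j * c j)"
    if "i' < d" for i i'
    using that by (simp add: l'_def algebra_simps sum_distrib_left sum_subtractf)
  have 2: "(\<Sum>j<N. r i j * l' j d) = \<delta> * (\<Sum>j<N. r i j * c j)" for i
    by (simp add: l'_def algebra_simps sum_distrib_left)
  have "(\<Sum>j<N. r i j * l' j i') = (if i = i' then r' q * \<delta> else 0)" if "i < Suc d" "i' < Suc d" for i i'
  proof -
    have "i < d \<or> i = d" "i' < d \<or> i' = d" using that by auto
    then show ?thesis
      by (elim disjE) (auto simp: 1 2 c0 cd l a_def[symmetric])
  qed
  then show ?case
    using \<delta> q(2) by (intro exI[of _ "r' q * \<delta>"] exI[of _ l']) auto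
qed

lemma index_mult_mat_sum:
  "A \<in> carrier_mat a b \<Longrightarrow> B \<in> carrier_mat b c \<Longrightarrow> i < a \<Longrightarrow> j < c \<Longrightarrow>
    (A * B) $$ (i, j) = (\<Sum>k<b. A $$ (i, k) * B $$ (k, j))"
  by (auto simp: scalar_prod_def lessThan_atLeast0 intro!: sum.cong)

text \<open>Cancellation tested on one-row matrices is linear independence of the rows of
  \<open>M\<close>.\<close>

lemma mat_epi_scaled_right_inverse:
  fixes M :: "'a::idom mat"
  assumes "mat_epi n d M"
  obtains \<delta> L where "\<delta> \<noteq> 0" "L \<in> carrier_mat n d" "M * L = \<delta> \<cdot>\<^sub>m 1\<^sub>m d"
proof -
  have M: "M \<in> carrier_mat d n" using assms by (simp add: mat_epi_def)
  have "\<forall>i<d. c i = 0" if c: "\<forall>j<n. (\<Sum>i<d. c i * M $$ (i, j)) = 0" for c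
  proof -
    let ?X = "mat 1 d (\<lambda>(_, i). c i)"
    have "?X * M = 0\<^sub>m 1 d * M"
      by (rule eq_matI) (use c M in \<open>auto simp del: index_mult_mat(1) simp: index_mult_mat_sum[of _ 1 d M n]\<close>)
    moreover have "?X \<in> carrier_mat 1 d" "0\<^sub>m 1 d \<in> carrier_mat 1 d" by auto
    ultimately have "?X = 0\<^sub>m 1 d"
      using assms unfolding mat_epi_def by blast
    then have "?X $$ (0, i) = 0" if "i < d" for i using that by simp
    then show ?thesis by simp
  qed
  from scaled_right_inverse_exists[where r = "\<lambda>i j. M $$ (i, j)" and N = n and d = d, OF this]
  obtain \<delta> l where "\<delta> \<noteq> 0" and
    l: "\<And>i i'. i < d \<Longrightarrow> i' < d \<Longrightarrow> (\<Sum>j<n. M $$ (i, j) * l j i') = (if i = i' then \<delta> else 0)"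
    by blast
  show thesis
  proof
    let ?L = "mat n d (\<lambda>(j, i). l j i)"
    show "M * ?L = \<delta> \<cdot>\<^sub>m 1\<^sub>m d"
    proof (rule eq_matI)
      fix i j assume "i < dim_row (\<delta> \<cdot>\<^sub>m 1\<^sub>m d)" "j < dim_col (\<delta> \<cdot>\<^sub>m 1\<^sub>m d)"
      then have "i < d" "j < d" by auto
      then show "(M * ?L) $$ (i, j) = (\<delta> \<cdot>\<^sub>m 1\<^sub>m d) $$ (i, j)"
        using l[of i j] by (subst index_mult_mat_sum[OF M, of ?L d]) auto
    qed (use M in auto)
  qed (use \<open>\<delta> \<noteq> 0\<close> in auto)
qed

section \<open>Matrices acting on trajectories\<close>

definition kernel_traj :: "nat \<Rightarrow> 'k::field laurent_poly mat \<Rightarrow> (int \<Rightarrow> 'k vec) set" where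
  "kernel_traj N M = {w \<in> trajectories N. theta M w = (\<lambda>_. 0\<^sub>v (dim_row M))}"

lemma theta_index:
  "M \<in> carrier_mat d N \<Longrightarrow> i < d \<Longrightarrow>
    theta M w t $ i = (\<Sum>j<N. laurent_act (M $$ (i, j)) (\<lambda>u. w u $ j) t)"
  by (auto simp: theta_def)

lemma theta_dim [simp]: "dim_vec (theta M w t) = dim_row M"
  by (simp add: theta_def)

lemma theta_carrier: "M \<in> carrier_mat d N \<Longrightarrow> theta M w t \<in> carrier_vec d"
  by (simp add: theta_def)

lemma theta_shift: "theta M (\<lambda>u. w (u - s)) t = theta M w (t - s)"
  by (simp add: theta_def laurent_act_def diff_diff_eq add.commute)

lemma theta_eq_0_iff:
  "M \<in> carrier_mat d N \<Longrightarrow> theta M w = (\<lambda>_. 0\<^sub>v d) \<longleftrightarrow>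
    (\<forall>i<d. \<forall>t. (\<Sum>j<N. laurent_act (M $$ (i, j)) (\<lambda>u. w u $ j) t) = 0)"
  by (auto simp: fun_eq_iff vec_eq_iff theta_index)

lemma theta_mult:
  assumes A: "A \<in> carrier_mat a b" and B: "B \<in> carrier_mat b c"
  shows "theta (A * B) v = theta A (theta B v)"
proof (intro ext eq_vecI)
  fix t i assume "i < dim_vec (theta A (theta B v) t)"
  then have i: "i < a" using A by simp
  have "theta (A * B) v t $ i =
      (\<Sum>j<c. \<Sum>k<b. laurent_act (A $$ (i, k)) (laurent_act (B $$ (k, j)) (\<lambda>u. v u $ j)) t)"
    unfolding theta_index[OF mult_carrier_mat[OF A B] i]
    by (rule sum.cong)
      (simp_all del: index_mult_mat add: index_mult_mat_sum[OF A B i] laurent_act_sum sum_fun_apply laurent_act_mult)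
  also have "\<dots> = (\<Sum>k<b. laurent_act (A $$ (i, k)) (\<lambda>u. theta B v u $ k) t)"
    by (subst sum.swap) (simp add: theta_index[OF B] laurent_act_sum_right)
  finally show "theta (A * B) v t $ i = theta A (theta B v) t $ i"
    by (simp add: theta_index[OF A i])
qed (use A in auto)

lemma theta_zero_right: "N = dim_col M \<Longrightarrow> theta M (\<lambda>_. 0\<^sub>v N) = (\<lambda>_. 0\<^sub>v (dim_row M))"
  by (auto simp: theta_def fun_eq_iff vec_eq_iff)

lemma theta_zero_left: "theta (0\<^sub>m d N) w = (\<lambda>_. 0\<^sub>v d)"
  by (auto simp: theta_def fun_eq_iff vec_eq_iff)

text \<open>A bound \<open>b\<close> on the absolute exponents in \<open>M\<close> is a window
  radius: the output at \<open>t\<close> depends only on inputs within distance \<open>b\<close>.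
  This makes patching possible.\<close>

lemma theta_local:
  obtains b where "b \<ge> 0"
    "\<And>w w' t. (\<And>u. \<bar>u - t\<bar> \<le> b \<Longrightarrow> w u = w' u) \<Longrightarrow> theta M w t = theta M w' t"
proof -
  let ?S = "\<Union>i<dim_row M. \<Union>j<dim_col M. Poly_Mapping.keys (M $$ (i, j))"
  \<comment> \<open>Inserting 0 keeps the maximum defined when all entries vanish, and
    nonnegative.\<close>
  let ?b = "Max (insert 0 (abs ` ?S))"
  have fin: "finite (insert 0 (abs ` ?S))" by simp
  have b: "\<bar>k\<bar> \<le> ?b" if "i < dim_row M" "j < dim_col M" "k \<in> Poly_Mapping.keys (M $$ (i, j))" for i j k
    by (rule Max_ge[OF fin]) (use that in blast)
  show thesis
  proof
    show "?b \<ge> 0" by (rule Max_ge[OF fin]) simp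
    show "theta M w t = theta M w' t" if "\<And>u. \<bar>u - t\<bar> \<le> ?b \<Longrightarrow> w u = w' u" for w w' t
    proof (rule eq_vecI)
      fix i assume "i < dim_vec (theta M w' t)"
      then show "theta M w t $ i = theta M w' t $ i"
        using b that by (auto simp: theta_def laurent_act_def intro!: sum.cong)
    qed simp
  qed
qed

text \<open>Preimages are unconstrained, so they can be patched freely; the patched preimage is then
  mapped forward by \<open>K\<close>.\<close>

lemma controllable_image:
  assumes K: "K \<in> carrier_mat N e"
  shows "controllable (theta K ` trajectories e)"
  unfolding controllable_def
proof (intro ballI allI)
  fix w w' t0 assume "w \<in> theta K ` trajectories e" "w' \<in> theta K ` trajectories e"
  then obtain v v' where v: "v \<in> trajectories e" "w = theta K v" and v': "v' \<in> trajectories e" "w' = theta K v'"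
    by blast
  obtain b where b: "b \<ge> 0"
    "\<And>w w' t. (\<And>u. \<bar>u - t\<bar> \<le> b \<Longrightarrow> w u = w' u) \<Longrightarrow> theta K w t = theta K w' t"
    using theta_local[of K] by blast
  \<comment> \<open>Outputs up to \<open>t0\<close> read inputs up to \<open>t0 + b\<close>, and
    outputs from \<open>t1\<close> on read inputs from \<open>t0 + b + 1\<close> on, exactly where
    \<open>v''\<close> switches.\<close>
  define t1 where "t1 = t0 + 2 * b + 1"
  define v'' where "v'' u = (if u \<le> t0 + b then v u else v' (u - t1))" for u
  have "v'' \<in> trajectories e" using v v' by (auto simp: v''_def trajectories_def)
  moreover have "t1 > t0" using b(1) by (simp add: t1_def)
  moreover have "theta K v'' t = w t" if "t \<le> t0" for t
    unfolding v(2) by (rule b(2)) (use that in \<open>auto simp: v''_def\<close>)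
  moreover have "theta K v'' t = w' (t - t1)" if "t \<ge> t1" for t
  proof -
    have "theta K v'' t = theta K (\<lambda>u. v' (u - t1)) t"
      by (rule b(2)) (use that in \<open>auto simp: v''_def t1_def\<close>)
    then show ?thesis by (simp add: v'(2) theta_shift)
  qed
  ultimately show "\<exists>w''\<in>theta K ` trajectories e. \<exists>t0'. t0' > t0 \<and>
      (\<forall>t\<le>t0. w'' t = w t) \<and> (\<forall>t\<ge>t0'. w'' t = w' (t - t0'))"
    by blast
qed

text \<open>Double annihilator: a row of \<open>Z\<close> outside the row space of \<open>M\<close>
  would be nonzero on some trajectory in the kernel.\<close>

lemma row_space_separation_mat:
  assumes M: "M \<in> carrier_mat d N" and Z: "Z \<in> carrier_mat p N"
    and ker: "\<And>w. w \<in> kernel_traj N M \<Longrightarrow> theta Z w = (\<lambda>_. 0\<^sub>v p)"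
  shows "\<exists>Y\<in>carrier_mat p d. Z = Y * M"
proof -
  have "\<exists>c. \<forall>j<N. Z $$ (i, j) = (\<Sum>i'<d. c i' * M $$ (i', j))" if i: "i < p" for i
  proof (rule ccontr)
    assume "\<not> ?thesis"
    then have "\<And>c. \<exists>j<N. Z $$ (i, j) \<noteq> (\<Sum>i'<d. c i' * M $$ (i', j))" by blast
    from row_space_separation[where M = "\<lambda>i j. M $$ (i, j)" and Z = "\<lambda>j. Z $$ (i, j)" and N = N and d = d, OF this]
    obtain w t where w: "\<And>i t. i < d \<Longrightarrow> (\<Sum>j<N. laurent_act (M $$ (i, j)) (w j) t) = 0"
      and t: "(\<Sum>j<N. laurent_act (Z $$ (i, j)) (w j) t) \<noteq> 0" by blast
    let ?w = "\<lambda>t. vec N (\<lambda>j. w j t)"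
    have "?w \<in> kernel_traj N M"
      using M w theta_eq_0_iff[OF M, of ?w] by (simp add: kernel_traj_def trajectories_def)
    from ker[OF this] have "theta Z ?w t $ i = 0" using i by simp
    then show False using t by (simp add: theta_index[OF Z i])
  qed
  then obtain c where c: "\<And>i j. i < p \<Longrightarrow> j < N \<Longrightarrow> Z $$ (i, j) = (\<Sum>i'<d. c i i' * M $$ (i', j))"
    by metis
  let ?Y = "mat p d (\<lambda>(i, i'). c i i')"
  have "Z = ?Y * M"
    by (rule eq_matI) (use M Z in \<open>auto simp del: index_mult_mat(1) simp: c index_mult_mat_sum[of _ p d M N]\<close>)
  then show ?thesis by (intro bexI[of _ ?Y]) auto
qed

text \<open>Exactness of rows at the middle term passes to trajectories: \<open>M * K = 0\<close>
  gives one inclusion, and factoring evaluation functionals through \<open>K\<close> gives the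
  other.\<close>

lemma kernel_traj_eq_image:
  assumes M: "M \<in> carrier_mat d N" and K: "K \<in> carrier_mat N e" and MK: "M * K = 0\<^sub>m d e"
    and ker: "\<And>X. X \<in> carrier_mat 1 N \<Longrightarrow> X * K = 0\<^sub>m 1 e \<Longrightarrow> \<exists>Y\<in>carrier_mat 1 d. X = Y * M"
  shows "kernel_traj N M = theta K ` trajectories e"
proof (intro equalityI subsetI)
  fix w assume w: "w \<in> kernel_traj N M"
  have "\<exists>v. \<forall>j<N. \<forall>t. w t $ j = (\<Sum>l<e. laurent_act (K $$ (j, l)) (v l) t)"
  proof (rule kernel_representation_imp_image[where d = d and M = "\<lambda>i j. M $$ (i, j)"])
    show "(\<Sum>j<N. laurent_act (M $$ (i, j)) (\<lambda>t. w t $ j) t) = 0" if "i < d" for i t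
      using w theta_eq_0_iff[OF M, of w] M that by (auto simp: kernel_traj_def)
    fix X assume X: "\<forall>l<e. (\<Sum>j<N. X j * K $$ (j, l)) = 0"
    let ?X = "mat 1 N (\<lambda>(_, j). X j)"
    have "?X * K = 0\<^sub>m 1 e"
      by (rule eq_matI) (use K X in \<open>auto simp del: index_mult_mat(1) simp: index_mult_mat_sum[of _ 1 N K e]\<close>)
    then obtain Y where Y: "Y \<in> carrier_mat 1 d" "?X = Y * M" using ker[of ?X] by auto
    have "X j = (\<Sum>i<d. Y $$ (0, i) * M $$ (i, j))" if "j < N" for j
      using arg_cong[OF Y(2), of "\<lambda>A. A $$ (0, j)"] that
      by (simp del: index_mult_mat(1) add: index_mult_mat_sum[OF Y(1) M])
    then show "\<exists>c. \<forall>j<N. X j = (\<Sum>i<d. c i * M $$ (i, j))"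
      by (intro exI[of _ "\<lambda>i. Y $$ (0, i)"]) simp
  qed
  then obtain v where v: "\<And>j t. j < N \<Longrightarrow> w t $ j = (\<Sum>l<e. laurent_act (K $$ (j, l)) (v l) t)"
    by blast
  let ?v = "\<lambda>t. vec e (\<lambda>l. v l t)"
  have "w = theta K ?v"
  proof (intro ext eq_vecI)
    fix t
    show "dim_vec (w t) = dim_vec (theta K ?v t)"
      using w K by (auto simp: kernel_traj_def trajectories_def dest: spec[of _ t])
    fix j assume "j < dim_vec (theta K ?v t)"
    then show "w t $ j = theta K ?v t $ j" using K v[of j t] by (simp add: theta_index[OF K])
  qed
  then show "w \<in> theta K ` trajectories e" by (auto simp: trajectories_def)
next
  fix w assume "w \<in> theta K ` trajectories e"
  then show "w \<in> kernel_traj N M"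
    using K M MK theta_mult[OF M K] by (auto simp: kernel_traj_def trajectories_def theta_zero_left theta_carrier)
qed

text \<open>Controllability makes rows modulo the row space of \<open>M\<close> torsion-free. By the
  double annihilator it suffices that \<open>Z\<close> vanishes on the kernel of
  \<open>M\<close>.\<close>

lemma controllable_imp_row_space_saturated:
  assumes M: "M \<in> carrier_mat d N" and contr: "controllable (kernel_traj N M)"
    and Z: "Z \<in> carrier_mat p N" and Y: "Y \<in> carrier_mat p d"
    and \<delta>: "\<delta> \<noteq> 0" "\<delta> \<cdot>\<^sub>m Z = Y * M"
  shows "\<exists>X\<in>carrier_mat p d. Z = X * M"
proof (rule row_space_separation_mat[OF M Z])
  fix w assume w: "w \<in> kernel_traj N M"
  obtain b where b: "b \<ge> 0"
    "\<And>w w' t. (\<And>u. \<bar>u - t\<bar> \<le> b \<Longrightarrow> w u = w' u) \<Longrightarrow> theta Z w t = theta Z w' t"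
    using theta_local[of Z] by blast
  have zero: "(\<lambda>_. 0\<^sub>v N) \<in> kernel_traj N M"
    using M by (simp add: kernel_traj_def trajectories_def theta_zero_right)
  have "theta Z w t = 0\<^sub>v p" for t
  proof -
    \<comment> \<open>The patch keeps \<open>w\<close> up to \<open>t + b\<close>, the whole window
      that \<open>Z\<close> reads at time \<open>t\<close>.\<close>
    obtain w1 t1 where w1: "w1 \<in> kernel_traj N M"
      and past: "\<And>u. u \<le> t + b \<Longrightarrow> w1 u = w u" and future: "\<And>u. u \<ge> t1 \<Longrightarrow> w1 u = 0\<^sub>v N"
      using contr[unfolded controllable_def, rule_format, OF w zero, of "t + b"] by auto
    have "theta Z w t = theta Z w1 t" by (rule b(2)) (use past in auto)
    also have "\<dots> = 0\<^sub>v p"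
    proof (rule eq_vecI)
      fix i assume "i < dim_vec (0\<^sub>v p)"
      then have i: "i < p" by simp
      have "laurent_act \<delta> (\<lambda>u. theta Z w1 u $ i) = (\<lambda>_. 0)"
      proof
        fix u
        have "theta (\<delta> \<cdot>\<^sub>m Z) w1 u $ i = 0"
          using \<delta> Y M Z w1 i by (simp add: theta_mult[OF Y M] kernel_traj_def theta_zero_right)
        moreover have "theta (\<delta> \<cdot>\<^sub>m Z) w1 u $ i = laurent_act \<delta> (\<lambda>u. theta Z w1 u $ i) u"
          using i Z theta_index[of "\<delta> \<cdot>\<^sub>m Z" p N i w1 u] theta_index[OF Z i, of w1]
          by (simp add: laurent_act_mult laurent_act_sum_right)
        ultimately show "laurent_act \<delta> (\<lambda>u. theta Z w1 u $ i) u = 0" by simp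
      qed
      \<comment> \<open>From \<open>t1 + b\<close> on, the window of \<open>Z\<close> meets only the
        zero part of \<open>w1\<close>.\<close>
      moreover have "theta Z w1 u $ i = 0" if "u \<ge> t1 + b" for u
      proof -
        have "theta Z w1 u = theta Z (\<lambda>_. 0\<^sub>v N) u"
          by (rule b(2)) (use future that in auto)
        then show ?thesis using Z i by (simp add: theta_zero_right)
      qed
      ultimately have "(\<lambda>u. theta Z w1 u $ i) = 0"
        using laurent_act_eq_0_imp[OF \<delta>(1)] by (simp add: zero_fun_def) blast
      then show "theta Z w1 t $ i = 0\<^sub>v p $ i"
        using i by (simp add: fun_eq_iff)
    qed (use Z in auto)
    finally show ?thesis .
  qed
  then show "theta Z w = (\<lambda>_. 0\<^sub>v p)" by blast
qed

section \<open>Corelations and pushouts\<close>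

lemma mult_mat_left_inverse:
  "V * U = 1\<^sub>m m \<Longrightarrow> U \<in> carrier_mat d m \<Longrightarrow> V \<in> carrier_mat m d \<Longrightarrow> X \<in> carrier_mat m n \<Longrightarrow>
    V * (U * X) = X"
  for V :: "'a::semiring_1 mat"
  using assoc_mult_mat[of V m d U m X n] by simp

lemma mult_mat_right_inverse:
  "U * V = 1\<^sub>m m \<Longrightarrow> U \<in> carrier_mat m d \<Longrightarrow> V \<in> carrier_mat d m \<Longrightarrow> X \<in> carrier_mat n m \<Longrightarrow>
    X * U * V = X"
  for V :: "'a::semiring_1 mat"
  using assoc_mult_mat[of X n m U d V m] by simp

lemma mult_right_iso_eq_iff:
  fixes U :: "'a::semiring_1 mat"
  assumes U: "U \<in> carrier_mat d m" "U' \<in> carrier_mat m d" "U' * U = 1\<^sub>m m" "U * U' = 1\<^sub>m d"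
    and "C \<in> carrier_mat p d" "X \<in> carrier_mat p m"
  shows "C * U = X \<longleftrightarrow> C = X * U'"
  using mult_mat_right_inverse[OF U(4,1,2) assms(5)] mult_mat_right_inverse[OF U(3,2,1) assms(6)] by metis

lemma minus_mat_eq_0_iff:
  assumes "C \<in> carrier_mat p e" "D \<in> carrier_mat p e"
  shows "C - D = 0\<^sub>m p e \<longleftrightarrow> C = (D :: 'a::group_add mat)"
  using assms by (auto simp: mat_eq_iff)

lemma sum_lessThan_add: "(\<Sum>k<m + n. f k) = (\<Sum>k<m. f k) + (\<Sum>k<n. f (m + k))"
  for n :: nat and f :: "nat \<Rightarrow> 'a::comm_monoid_add"
  by (induction n) (auto simp: add.assoc)

section \<open>Block rows and stacked matrices\<close>

lemma copairing_carrier [simp]: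
  "A \<in> carrier_mat d m \<Longrightarrow> B \<in> carrier_mat d n \<Longrightarrow> copairing A B \<in> carrier_mat d (m + n)"
  by (auto simp: copairing_def)

lemma copairing_index:
  "A \<in> carrier_mat d m \<Longrightarrow> B \<in> carrier_mat d n \<Longrightarrow> i < d \<Longrightarrow> j < m + n \<Longrightarrow>
    copairing A B $$ (i, j) = (if j < m then A $$ (i, j) else B $$ (i, j - m))"
  by (auto simp: copairing_def)

lemma mult_copairing:
  assumes "U \<in> carrier_mat c d" "A \<in> carrier_mat d m" "B \<in> carrier_mat d n"
  shows "U * copairing A B = copairing (U * A) (U * B)"
proof (rule eq_matI)
  fix i j assume "i < dim_row (copairing (U * A) (U * B))" "j < dim_col (copairing (U * A) (U * B))"
  then have "i < c" "j < m + n" using assms by (auto simp: copairing_def)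
  then show "(U * copairing A B) $$ (i, j) = copairing (U * A) (U * B) $$ (i, j)"
    using assms
    by (simp del: index_mult_mat(1) add: copairing_index[of _ c m _ n] copairing_index[of _ d m _ n]
        index_mult_mat_sum[of U c d _ "m + n"] index_mult_mat_sum[of U c d _ m] index_mult_mat_sum[of U c d _ n])
qed (use assms in \<open>auto simp: copairing_def\<close>)

lemma copairing_eq_iff:
  assumes "A \<in> carrier_mat d m" "B \<in> carrier_mat d n" "A' \<in> carrier_mat d m" "B' \<in> carrier_mat d n"
  shows "copairing A B = copairing A' B' \<longleftrightarrow> A = A' \<and> B = B'"
proof
  assume eq: "copairing A B = copairing A' B'"
  have "A $$ (i, j) = A' $$ (i, j)" if "i < d" "j < m" for i j
    using arg_cong[OF eq, of "\<lambda>M. M $$ (i, j)"] that assms by (simp add: copairing_index[of _ d m _ n])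
  moreover have "B $$ (i, j) = B' $$ (i, j)" if "i < d" "j < n" for i j
    using arg_cong[OF eq, of "\<lambda>M. M $$ (i, m + j)"] that assms by (simp add: copairing_index[of _ d m _ n])
  ultimately show "A = A' \<and> B = B'" using assms by (auto intro!: eq_matI)
qed simp

lemma copairing_cases:
  assumes "M \<in> carrier_mat d (m + n)"
  obtains A B where "A \<in> carrier_mat d m" "B \<in> carrier_mat d n" "M = copairing A B"
proof
  let ?A = "mat d m (\<lambda>(i, j). M $$ (i, j))" and ?B = "mat d n (\<lambda>(i, j). M $$ (i, m + j))"
  show "?A \<in> carrier_mat d m" "?B \<in> carrier_mat d n" by auto
  show "M = copairing ?A ?B"
    by (rule eq_matI) (use assms in \<open>auto simp: copairing_index[of _ d m _ n] copairing_def\<close>)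
qed

lemma append_rows_index:
  "R \<in> carrier_mat m e \<Longrightarrow> S \<in> carrier_mat n e \<Longrightarrow> i < m + n \<Longrightarrow> j < e \<Longrightarrow>
    (R @\<^sub>r S) $$ (i, j) = (if i < m then R $$ (i, j) else S $$ (i - m, j))"
  by (auto simp: append_rows_def)

lemma append_rows_cases:
  assumes "K \<in> carrier_mat (m + n) e"
  obtains R S where "R \<in> carrier_mat m e" "S \<in> carrier_mat n e" "K = R @\<^sub>r S"
proof
  let ?R = "mat m e (\<lambda>(i, j). K $$ (i, j))" and ?S = "mat n e (\<lambda>(i, j). K $$ (m + i, j))"
  show "?R \<in> carrier_mat m e" "?S \<in> carrier_mat n e" by auto
  show "K = ?R @\<^sub>r ?S"
    by (rule eq_matI) (use assms in \<open>auto simp: append_rows_index[of _ m e _ n] append_rows_def\<close>)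
qed

lemma copairing_mult_append_rows:
  assumes "X \<in> carrier_mat p m" "Y \<in> carrier_mat p n" "R \<in> carrier_mat m e" "S \<in> carrier_mat n e"
  shows "copairing X Y * (R @\<^sub>r S) = X * R + Y * S"
proof (rule eq_matI)
  fix i j assume "i < dim_row (X * R + Y * S)" "j < dim_col (X * R + Y * S)"
  then have "i < p" "j < e" using assms by auto
  then show "(copairing X Y * (R @\<^sub>r S)) $$ (i, j) = (X * R + Y * S) $$ (i, j)"
    using assms
    by (simp del: index_mult_mat(1) add: index_mult_mat_sum[of _ p "m + n" _ e]
        index_mult_mat_sum[of X p m R e] index_mult_mat_sum[of Y p n S e] sum_lessThan_add
        copairing_index[of X p m Y n] append_rows_index[of R m e S n])
qed (use assms in \<open>auto simp: copairing_def append_rows_def\<close>)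

text \<open>The bridge between cocones on a span and the left kernel of its stacked matrix; the sign
  turns an equation of products into a vanishing sum.\<close>

lemma copairing_uminus_mult_append_rows_eq_0_iff:
  assumes "X \<in> carrier_mat p m" "Y \<in> carrier_mat p n" "R \<in> carrier_mat m e" "S \<in> carrier_mat n e"
  shows "copairing X (- Y) * (R @\<^sub>r S) = 0\<^sub>m p e \<longleftrightarrow> X * R = Y * (S :: 'a::comm_ring_1 mat)"
proof -
  have XR: "X * R \<in> carrier_mat p e" and YS: "Y * S \<in> carrier_mat p e" using assms by auto
  have "copairing X (- Y) * (R @\<^sub>r S) = X * R - Y * S"
    using assms XR YS by (subst copairing_mult_append_rows[of X p m _ n R e S])
      (auto simp: minus_add_uminus_mat[OF XR YS])
  then show ?thesis using minus_mat_eq_0_iff[OF XR YS] by simp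
qed

lemma corelation_epiD:
  assumes "corelation m d n A B" "X \<in> carrier_mat p d" "Y \<in> carrier_mat p d"
    "X * A = Y * A" "X * B = Y * B"
  shows "X = Y"
proof -
  have AB: "A \<in> carrier_mat d m" "B \<in> carrier_mat d n" and epi: "mat_epi (m + n) d (copairing A B)"
    using assms(1) by (auto simp: corelation_def)
  have "X * copairing A B = Y * copairing A B"
    using mult_copairing[OF assms(2) AB] mult_copairing[OF assms(3) AB] assms(4,5) by simp
  then show ?thesis using epi assms(2,3) unfolding mat_epi_def by blast
qed

lemma corelationI:
  assumes "A \<in> carrier_mat d m" "B \<in> carrier_mat d n"
    and epi: "\<And>p X Y. X \<in> carrier_mat p d \<Longrightarrow> Y \<in> carrier_mat p d \<Longrightarrow>
      X * A = Y * A \<Longrightarrow> X * B = Y * B \<Longrightarrow> X = Y"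
  shows "corelation m d n A B"
  unfolding corelation_def mat_epi_def
proof (intro conjI ballI allI impI)
  fix p X Y assume X: "X \<in> carrier_mat p d" and Y: "Y \<in> carrier_mat p d"
    and eq: "X * copairing A B = Y * copairing A B"
  then have "X * A = Y * A \<and> X * B = Y * B"
    using assms(1,2) copairing_eq_iff[of "X * A" p m "X * B" n "Y * A" "Y * B"]
    by (simp add: mult_copairing[of _ p d A m B n])
  then show "X = Y" using epi X Y by blast
qed (use assms in auto)

text \<open>Needed because the behaviour is the kernel of \<open>[A, -B]\<close>, whereas the epi
  condition concerns \<open>[A, B]\<close>.\<close>

lemma corelation_uminus_right:
  assumes "corelation m d n A B"
  shows "corelation m d n A (- B)"
proof (rule corelationI)
  fix p X Y assume "X \<in> carrier_mat p d" "Y \<in> carrier_mat p d" "X * A = Y * A" "X * - B = Y * - B"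
  moreover from this have "- (X * B) = - (Y * B)" using assms by (auto simp: corelation_def)
  then have "X * B = Y * B" by (metis uminus_uminus_mat)
  ultimately show "X = Y" using corelation_epiD[OF assms] by blast
qed (use assms in \<open>auto simp: corelation_def\<close>)

lemma corel_classE:
  assumes "(A', B') \<in> corel_class m n A B" "A \<in> carrier_mat d m" "A' \<in> carrier_mat d' m"
  obtains U V where "U \<in> carrier_mat d' d" "V \<in> carrier_mat d d'" "V * U = 1\<^sub>m d" "U * V = 1\<^sub>m d'"
    "A' = U * A" "B' = U * B"
proof -
  from assms(1) obtain d1 d1' U where c: "corelation m d1 n A B" "corelation m d1' n A' B'"
      and U: "mat_iso d1 d1' U" "U * A = A'" "U * B = B'"
    by (auto simp: corel_class_def corel_iso_def)
  \<comment> \<open>A class stores no apex; it is recovered from the number of rows.\<close>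
  have "d1 = d" "d1' = d'" using c assms(2,3) by (auto simp: corelation_def)
  with U that show thesis by (auto simp: mat_iso_def)
qed

lemma corel_class_self: "corelation m d n A B \<Longrightarrow> (A, B) \<in> corel_class m n A B"
  using equiv_corel_iso[of m n] by (force simp: corel_class_def equiv_def refl_on_def)

section \<open>Pushouts and the corelation of a span\<close>

lemma mat_pushoutI:
  assumes "R \<in> carrier_mat m e" "S \<in> carrier_mat n e" "P \<in> carrier_mat q m" "Q \<in> carrier_mat q n"
    and "P * R = Q * S"
    and "\<And>p X Y. X \<in> carrier_mat p m \<Longrightarrow> Y \<in> carrier_mat p n \<Longrightarrow> X * R = Y * S \<Longrightarrow>
      \<exists>!U. U \<in> carrier_mat p q \<and> U * P = X \<and> U * Q = Y"
  shows "mat_pushout e m n R S q P Q"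
  unfolding mat_pushout_def by (intro conjI allI ballI impI assms)

lemma mat_pushoutD:
  assumes "mat_pushout e m n R S q P Q"
  shows "R \<in> carrier_mat m e" "S \<in> carrier_mat n e" "P \<in> carrier_mat q m" "Q \<in> carrier_mat q n"
    "P * R = Q * S"
  using assms unfolding mat_pushout_def by blast+

lemma mat_pushout_factor:
  assumes "mat_pushout e m n R S q P Q" "X \<in> carrier_mat p m" "Y \<in> carrier_mat p n" "X * R = Y * S"
  obtains U where "U \<in> carrier_mat p q" "U * P = X" "U * Q = Y"
  using assms unfolding mat_pushout_def by blast

text \<open>Cocones on the two spans correspond by composition with \<open>U'\<close> and
  \<open>V'\<close>, and mediating arrows are the same. This absorbs the choice of representatives
  in a composite.\<close>

lemma mat_pushout_iso:
  assumes po: "mat_pushout e d d' (U * R) (V * S) q P Q"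
    and R: "R \<in> carrier_mat m e" and S: "S \<in> carrier_mat n e"
    and U: "U \<in> carrier_mat d m" "U' \<in> carrier_mat m d" "U' * U = 1\<^sub>m m" "U * U' = 1\<^sub>m d"
    and V: "V \<in> carrier_mat d' n" "V' \<in> carrier_mat n d'" "V' * V = 1\<^sub>m n" "V * V' = 1\<^sub>m d'"
  shows "mat_pushout e m n R S q (P * U) (Q * V)"
proof -
  have P: "P \<in> carrier_mat q d" and Q: "Q \<in> carrier_mat q d'" and eq: "P * (U * R) = Q * (V * S)"
    using po by (auto simp: mat_pushout_def)
  have ex: "\<exists>!W. W \<in> carrier_mat p q \<and> W * (P * U) = X \<and> W * (Q * V) = Y"
    if X: "X \<in> carrier_mat p m" and Y: "Y \<in> carrier_mat p n" and XY: "X * R = Y * S" for p X Y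
  proof -
    have "X * U' \<in> carrier_mat p d" "Y * V' \<in> carrier_mat p d'" using X Y U V by auto
    moreover have "(X * U') * (U * R) = (Y * V') * (V * S)"
      using X Y U V R S XY assoc_mult_mat[OF X U(2), of "U * R" e] assoc_mult_mat[OF Y V(2), of "V * S" e]
        mult_mat_left_inverse[OF U(3,1,2) R] mult_mat_left_inverse[OF V(3,1,2) S]
      by simp
    ultimately have "\<exists>!W. W \<in> carrier_mat p q \<and> W * P = X * U' \<and> W * Q = Y * V'"
      using po unfolding mat_pushout_def by blast
    moreover have "W * (P * U) = X \<longleftrightarrow> W * P = X * U'" if W: "W \<in> carrier_mat p q" for W
      using mult_right_iso_eq_iff[OF U mult_carrier_mat[OF W P] X] assoc_mult_mat[OF W P U(1)] by simp
    moreover have "W * (Q * V) = Y \<longleftrightarrow> W * Q = Y * V'" if W: "W \<in> carrier_mat p q" for W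
      using mult_right_iso_eq_iff[OF V mult_carrier_mat[OF W Q] Y] assoc_mult_mat[OF W Q V(1)] by simp
    ultimately show ?thesis by metis
  qed
  have "P * U * R = Q * V * S"
    using assoc_mult_mat[OF P U(1) R] assoc_mult_mat[OF Q V(1) S] eq by simp
  then show ?thesis
    by (intro mat_pushoutI R S mult_carrier_mat[OF P U(1)] mult_carrier_mat[OF Q V(1)] ex)
qed

lemma span_corelE:
  assumes R: "R \<in> carrier_mat m e" and S: "S \<in> carrier_mat n e"
    and AB: "(A, B) \<in> span_corel m e n R S"
  obtains c q P Q N where "corelation m c n A B" "mat_pushout e m n R S q P Q" "mat_split_mono c q N"
    "P = N * A" "Q = N * B"
proof -
  from AB obtain A0 B0 C0 D0 d d' q P Q c N where
    F: "(A0, B0) \<in> corel_class m e (1\<^sub>m m) R" "A0 \<in> carrier_mat d m" and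
    G: "(C0, D0) \<in> corel_class e n S (1\<^sub>m n)" "C0 \<in> carrier_mat d' e" and
    po: "mat_pushout e d d' B0 C0 q P Q" and
    cor: "A \<in> carrier_mat c m" "B \<in> carrier_mat c n" "mat_epi (m + n) c (copairing A B)" and
    N: "mat_split_mono c q N" "copairing (P * A0) (Q * D0) = N * copairing A B"
    unfolding span_corel_def corel_comp_def by blast
  obtain U U' where U: "U \<in> carrier_mat d m" "U' \<in> carrier_mat m d" "U' * U = 1\<^sub>m m" "U * U' = 1\<^sub>m d"
    "A0 = U * 1\<^sub>m m" "B0 = U * R"
    using corel_classE[OF F(1) _ F(2)] by (metis one_carrier_mat)
  obtain V V' where V: "V \<in> carrier_mat d' n" "V' \<in> carrier_mat n d'" "V' * V = 1\<^sub>m n" "V * V' = 1\<^sub>m d'"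
    "C0 = V * S" "D0 = V * 1\<^sub>m n"
    using corel_classE[OF G(1) S G(2)] by metis
  have po': "mat_pushout e m n R S q (P * U) (Q * V)"
    by (rule mat_pushout_iso[OF _ R S U(1-4) V(1-4)]) (use po U V in simp)
  have "copairing (P * U) (Q * V) = copairing (N * A) (N * B)"
    using N cor U V by (simp add: mult_copairing[of N q c A m B n] mat_split_mono_def)
  then have "P * U = N * A" "Q * V = N * B"
    using copairing_eq_iff[of "P * U" q m "Q * V" n "N * A" "N * B"] po' N(1) cor(1,2)
    by (auto simp: mat_pushout_def mat_split_mono_def)
  with that[OF _ po' N(1)] cor show thesis by (simp add: corelation_def)
qed

lemma span_corelI:
  assumes po: "mat_pushout e m n R S q P Q" and N: "mat_split_mono c q N"
    and c: "corelation m c n A B" and eq: "P = N * A" "Q = N * B"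
  shows "(A, B) \<in> span_corel m e n R S"
proof -
  have R: "R \<in> carrier_mat m e" and S: "S \<in> carrier_mat n e" and P: "P \<in> carrier_mat q m" and Q: "Q \<in> carrier_mat q n"
    using po by (auto simp: mat_pushout_def)
  have "corelation m m e (1\<^sub>m m) R" by (rule corelationI) (use R in auto)
  then have "(1\<^sub>m m, R) \<in> corel_class m e (1\<^sub>m m) R" by (rule corel_class_self)
  moreover have "corelation e n n S (1\<^sub>m n)" by (rule corelationI) (use S in auto)
  then have "(S, 1\<^sub>m n) \<in> corel_class e n S (1\<^sub>m n)" by (rule corel_class_self)
  moreover have "P * 1\<^sub>m m = P" "Q * 1\<^sub>m n = Q" using P Q by auto
  then have "copairing (P * 1\<^sub>m m) (Q * 1\<^sub>m n) = N * copairing A B"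
    using c N eq by (simp add: mult_copairing[of N q c A m B n] mat_split_mono_def corelation_def)
  ultimately show ?thesis
    using c N R S po unfolding span_corel_def corel_comp_def corelation_def
    by (intro CollectI case_prodI exI conjI) (assumption | rule one_carrier_mat | blast)+
qed

text \<open>The epi part of the factorised pushout inherits its universal property: the split mono
  supplies existence of mediating arrows and joint epi supplies uniqueness.\<close>

lemma span_corel_eq_corel_class_iff:
  assumes AB: "corelation m d n A B" and R: "R \<in> carrier_mat m e" and S: "S \<in> carrier_mat n e"
  shows "span_corel m e n R S = corel_class m n A B \<longleftrightarrow> mat_pushout e m n R S d A B"
proof
  have A: "A \<in> carrier_mat d m" and B: "B \<in> carrier_mat d n" using AB by (auto simp: corelation_def)
  assume "span_corel m e n R S = corel_class m n A B"
  then have "(A, B) \<in> span_corel m e n R S" using corel_class_self[OF AB] by simp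
  then obtain c q P Q N where c: "corelation m c n A B" and po: "mat_pushout e m n R S q P Q"
    and N: "mat_split_mono c q N" "P = N * A" "Q = N * B"
    using span_corelE[OF R S] by blast
  have [simp]: "c = d" using c AB by (auto dest: corelation_dim)
  obtain L where NL: "N \<in> carrier_mat q d" "L \<in> carrier_mat d q" "L * N = 1\<^sub>m d"
    using N(1) by (auto simp: mat_split_mono_def)
  \<comment> \<open>The square commutes after \<open>N\<close>, which has a left inverse.\<close>
  have "N * (A * R) = N * (B * S)"
    using po N NL assoc_mult_mat[OF NL(1) A R] assoc_mult_mat[OF NL(1) B S] by (simp add: mat_pushout_def)
  then have "L * (N * (A * R)) = L * (N * (B * S))" by simp
  then have ARBS: "A * R = B * S"
    using mult_mat_left_inverse[OF NL(3,1,2)] A B R S by (metis mult_carrier_mat)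
  have "\<exists>!W. W \<in> carrier_mat p d \<and> W * A = X \<and> W * B = Y"
    if X: "X \<in> carrier_mat p m" and Y: "Y \<in> carrier_mat p n" and XY: "X * R = Y * S" for p X Y
  proof -
    obtain H where H: "H \<in> carrier_mat p q" "H * P = X" "H * Q = Y"
      using mat_pushout_factor[OF po X Y XY] .
    then have "H * N \<in> carrier_mat p d" "H * N * A = X" "H * N * B = Y"
      using NL N assoc_mult_mat[OF H(1) NL(1) A] assoc_mult_mat[OF H(1) NL(1) B] by auto
    then show ?thesis
      by (intro ex1I[of _ "H * N"] conjI) (auto intro: corelation_epiD[OF AB])
  qed
  then show "mat_pushout e m n R S d A B"
    by (intro mat_pushoutI A B R S ARBS)
next
  have A: "A \<in> carrier_mat d m" and B: "B \<in> carrier_mat d n" using AB by (auto simp: corelation_def)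
  assume po: "mat_pushout e m n R S d A B"
  show "span_corel m e n R S = corel_class m n A B"
  proof (intro equalityI subrelI)
    fix A' B' assume "(A', B') \<in> span_corel m e n R S"
    then obtain c q P Q N where c: "corelation m c n A' B'" and po': "mat_pushout e m n R S q P Q"
      and N: "mat_split_mono c q N" "P = N * A'" "Q = N * B'"
      using span_corelE[OF R S] by blast
    have A': "A' \<in> carrier_mat c m" and B': "B' \<in> carrier_mat c n" using c by (auto simp: corelation_def)
    obtain L where NL: "N \<in> carrier_mat q c" "L \<in> carrier_mat c q" "L * N = 1\<^sub>m c"
      using N(1) by (auto simp: mat_split_mono_def)
    \<comment> \<open>The comparison arrows of the two pushouts, composed with \<open>N\<close> and
      its left inverse, relate the corelations both ways; joint epi makes the round trips
      identities.\<close>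
    obtain H where H: "H \<in> carrier_mat d q" "H * P = A" "H * Q = B"
      using mat_pushout_factor[OF po' mat_pushoutD(3-5)[OF po]] .
    obtain G where G: "G \<in> carrier_mat q d" "G * A = P" "G * B = Q"
      using mat_pushout_factor[OF po mat_pushoutD(3-5)[OF po']] .
    have LG: "L * G \<in> carrier_mat c d" and HN: "H * N \<in> carrier_mat d c" using NL G H by auto
    have 1: "L * G * A = A'" "L * G * B = B'"
      using assoc_mult_mat[OF NL(2) G(1) A] assoc_mult_mat[OF NL(2) G(1) B] G N
        mult_mat_left_inverse[OF NL(3,1,2) A'] mult_mat_left_inverse[OF NL(3,1,2) B'] by auto
    have 2: "H * N * A' = A" "H * N * B' = B"
      using assoc_mult_mat[OF H(1) NL(1) A'] assoc_mult_mat[OF H(1) NL(1) B'] H N by auto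
    have "H * N * (L * G) = 1\<^sub>m d"
      by (rule corelation_epiD[OF AB])
        (use LG HN 1 2 A B assoc_mult_mat[OF HN LG A] assoc_mult_mat[OF HN LG B] in auto)
    moreover have "L * G * (H * N) = 1\<^sub>m c"
      by (rule corelation_epiD[OF c])
        (use LG HN 1 2 A' B' assoc_mult_mat[OF LG HN A'] assoc_mult_mat[OF LG HN B'] in auto)
    ultimately have "mat_iso d c (L * G)" using LG HN by (auto simp: mat_iso_def)
    then show "(A', B') \<in> corel_class m n A B"
      using AB c 1 unfolding corel_class_def corel_iso_def by blast
  next
    fix A' B' assume cl: "(A', B') \<in> corel_class m n A B"
    then obtain d' where c: "corelation m d' n A' B'"
      by (auto simp: corel_class_def corel_iso_def)
    then have "A' \<in> carrier_mat d' m" by (simp add: corelation_def)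
    from corel_classE[OF cl A this] obtain U V where
      UV: "U \<in> carrier_mat d' d" "V \<in> carrier_mat d d'" "V * U = 1\<^sub>m d" "U * V = 1\<^sub>m d'"
        "A' = U * A" "B' = U * B" by metis
    \<comment> \<open>The inverse isomorphism, read as a split mono, factors the given pushout
      through \<open>(A', B')\<close>.\<close>
    have "mat_split_mono d' d V" using UV by (auto simp: mat_split_mono_def)
    moreover have "A = V * A'" "B = V * B'"
      using UV mult_mat_left_inverse[OF UV(3,1,2) A] mult_mat_left_inverse[OF UV(3,1,2) B] by auto
    ultimately show "(A', B') \<in> span_corel m e n R S"
      by (rule span_corelI[OF po _ c])
  qed
qed

section \<open>Behaviours of corelations\<close>

lemma theta_copairing_eq_0_iff:
  assumes A: "A \<in> carrier_mat d m" and B: "B \<in> carrier_mat d n"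
    and x: "x \<in> trajectories m" and y: "y \<in> trajectories n"
  shows "theta (copairing A (- B)) (\<lambda>t. x t @\<^sub>v y t) = (\<lambda>_. 0\<^sub>v d) \<longleftrightarrow> theta A x = theta B y"
proof -
  have B': "- B \<in> carrier_mat d n" using B by simp
  have dims: "dim_vec (x t) = m" "dim_vec (y t) = n" for t
    using x y by (auto simp: trajectories_def dest: spec[of _ t])
  have "(\<Sum>j<m + n. laurent_act (copairing A (- B) $$ (i, j)) (\<lambda>u. (x u @\<^sub>v y u) $ j) t) =
      theta A x t $ i - theta B y t $ i" if "i < d" for i t
    using that B
    by (simp add: sum_lessThan_add copairing_index[OF A B'] dims theta_index[OF A] theta_index[OF B]
        laurent_act_uminus sum_negf)
  then have "theta (copairing A (- B)) (\<lambda>t. x t @\<^sub>v y t) = (\<lambda>_. 0\<^sub>v d) \<longleftrightarrow>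
      (\<forall>i<d. \<forall>t. theta A x t $ i - theta B y t $ i = 0)"
    unfolding theta_eq_0_iff[OF copairing_carrier[OF A B']] by simp
  also have "\<dots> \<longleftrightarrow> theta A x = theta B y"
    using A B by (auto simp: fun_eq_iff vec_eq_iff)
  finally show ?thesis .
qed

lemma behaviour_eq_kernel_traj:
  assumes A: "A \<in> carrier_mat d m" and B: "B \<in> carrier_mat d n"
  shows "behaviour m n A B = kernel_traj (m + n) (copairing A (- B))"
proof -
  have "dim_row (copairing A (- B)) = d" using A by (simp add: copairing_def)
  note ker = kernel_traj_def[of _ "copairing A (- B)", unfolded this]
  show ?thesis
  proof (intro equalityI subsetI)
    fix w assume "w \<in> behaviour m n A B"
    then obtain x y where w: "w = (\<lambda>t. x t @\<^sub>v y t)" "x \<in> trajectories m" "y \<in> trajectories n"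
      and eq: "theta A x = theta B y"
      unfolding behaviour_def by blast
    have "w \<in> trajectories (m + n)" using w by (auto simp: trajectories_def)
    with w eq show "w \<in> kernel_traj (m + n) (copairing A (- B))"
      by (simp add: ker theta_copairing_eq_0_iff[OF A B])
  next
    fix w assume w: "w \<in> kernel_traj (m + n) (copairing A (- B))"
    let ?x = "\<lambda>t. vec_first (w t) m" and ?y = "\<lambda>t. vec_last (w t) n"
    have eq: "w = (\<lambda>t. ?x t @\<^sub>v ?y t)"
      using w by (auto simp: ker trajectories_def)
    have xy: "?x \<in> trajectories m" "?y \<in> trajectories n" by (auto simp: trajectories_def)
    have "theta (copairing A (- B)) (\<lambda>t. ?x t @\<^sub>v ?y t) = (\<lambda>_. 0\<^sub>v d)"
      using w eq by (simp add: ker)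
    then have "theta A ?x = theta B ?y"
      by (simp add: theta_copairing_eq_0_iff[OF A B xy])
    with xy eq show "w \<in> behaviour m n A B"
      unfolding behaviour_def by (intro CollectI exI[of _ ?x] exI[of _ ?y] conjI)
  qed
qed

text \<open>The universal property on one-row cocones says that the rows of \<open>[A, -B]\<close>
  generate the left kernel of the stacked matrix, so the behaviour is an image.\<close>

lemma pushout_imp_controllable:
  assumes "mat_pushout e m n R S d A B"
  shows "controllable (behaviour m n A B)"
proof -
  have R: "R \<in> carrier_mat m e" and S: "S \<in> carrier_mat n e"
    and A: "A \<in> carrier_mat d m" and B: "B \<in> carrier_mat d n" and eq: "A * R = B * S"
    using assms by (auto simp: mat_pushout_def)
  have M: "copairing A (- B) \<in> carrier_mat d (m + n)" using A B by simp
  have K: "R @\<^sub>r S \<in> carrier_mat (m + n) e" using R S by simp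
  have "kernel_traj (m + n) (copairing A (- B)) = theta (R @\<^sub>r S) ` trajectories e"
  proof (rule kernel_traj_eq_image[OF M K])
    show "copairing A (- B) * (R @\<^sub>r S) = 0\<^sub>m d e"
      using eq by (simp add: copairing_uminus_mult_append_rows_eq_0_iff[OF A B R S])
    fix X assume XC: "X \<in> carrier_mat 1 (m + n)" and X0: "X * (R @\<^sub>r S) = 0\<^sub>m 1 e"
    obtain X1 X2 where X: "X1 \<in> carrier_mat 1 m" "X2 \<in> carrier_mat 1 n" "X = copairing X1 X2"
      using XC by (rule copairing_cases)
    \<comment> \<open>The second leg of a cocone enters with the opposite sign.\<close>
    have X2: "- X2 \<in> carrier_mat 1 n" and [simp]: "- (- X2) = X2" using X by auto
    have "X1 * R = - X2 * S"
      using X0 X copairing_uminus_mult_append_rows_eq_0_iff[OF X(1) X2 R S] by simp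
    then obtain U where U: "U \<in> carrier_mat 1 d" "U * A = X1" "U * B = - X2"
      by (rule mat_pushout_factor[OF assms X(1) X2])
    have "U * copairing A (- B) = X"
      using U A B X by (simp add: mult_copairing[of U 1 d A m "- B" n])
    then show "\<exists>Y\<in>carrier_mat 1 d. X = Y * copairing A (- B)" using U(1) by blast
  qed
  then show ?thesis
    using controllable_image[OF K] by (simp add: behaviour_eq_kernel_traj[OF A B])
qed

text \<open>Cocones on the span cut from \<open>E\<close> are rows whose
  \<open>\<delta>\<close>-multiple lies in the row space of \<open>M\<close>. Saturation removes
  \<open>\<delta>\<close>, which yields the mediating arrow.\<close>

lemma controllable_imp_pushout:
  fixes A B :: "'k::field laurent_poly mat"
  assumes AB: "corelation m d n A B" and contr: "controllable (behaviour m n A B)"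
  shows "\<exists>e. \<exists>R\<in>carrier_mat m e. \<exists>S\<in>carrier_mat n e. mat_pushout e m n R S d A B"
proof -
  have A: "A \<in> carrier_mat d m" and B: "B \<in> carrier_mat d n" using AB by (auto simp: corelation_def)
  let ?N = "m + n"
  define M where "M = copairing A (- B)"
  have M: "M \<in> carrier_mat d ?N" using A B by (simp add: M_def)
  have "mat_epi ?N d M"
    using corelation_uminus_right[OF AB] by (simp add: M_def corelation_def)
  then obtain \<delta> L where \<delta>: "\<delta> \<noteq> 0" and L: "L \<in> carrier_mat ?N d" and MtL: "M * L = \<delta> \<cdot>\<^sub>m 1\<^sub>m d"
    by (rule mat_epi_scaled_right_inverse)
  define E where "E = \<delta> \<cdot>\<^sub>m 1\<^sub>m ?N - L * M"
  have E: "E \<in> carrier_mat ?N ?N" using L M by (auto simp: E_def)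
  \<comment> \<open>So \<open>Z * E\<close> vanishes exactly when \<open>\<delta>\<close> times
    \<open>Z\<close> equals \<open>(Z * L) * M\<close>.\<close>
  have mult_E: "Z * E = \<delta> \<cdot>\<^sub>m Z - (Z * L) * M" if Z: "Z \<in> carrier_mat p ?N" for Z p
    using Z L M assoc_mult_mat[OF Z L M] mult_smult_distrib[OF Z one_carrier_mat, of \<delta>]
    by (simp add: E_def mult_minus_distrib_mat[OF Z _ mult_carrier_mat[OF L M]])
  have "M * E = 0\<^sub>m d ?N"
    using M mult_smult_assoc_mat[OF one_carrier_mat M, of \<delta>] by (simp add: mult_E[OF M] MtL)
  \<comment> \<open>The witness span has apex \<open>m + n\<close>; its legs are the upper and lower
    row blocks of \<open>E\<close>.\<close>
  obtain R S where R: "R \<in> carrier_mat m ?N" and S: "S \<in> carrier_mat n ?N" and RS: "E = R @\<^sub>r S"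
    using E by (rule append_rows_cases)
  have eq_iff: "copairing X (- Y) * E = 0\<^sub>m p ?N \<longleftrightarrow> X * R = Y * S"
    if "X \<in> carrier_mat p m" "Y \<in> carrier_mat p n" for X Y p
    using copairing_uminus_mult_append_rows_eq_0_iff[OF that R S] by (simp add: RS)
  have "mat_pushout ?N m n R S d A B"
  proof (rule mat_pushoutI[OF R S A B])
    show "A * R = B * S" using \<open>M * E = 0\<^sub>m d ?N\<close> eq_iff[OF A B] by (simp add: M_def)
    fix p X Y assume X: "X \<in> carrier_mat p m" and Y: "Y \<in> carrier_mat p n" and "X * R = Y * S"
    let ?Z = "copairing X (- Y)"
    have Z: "?Z \<in> carrier_mat p ?N" using X Y by simp
    have "\<delta> \<cdot>\<^sub>m ?Z - (?Z * L) * M = 0\<^sub>m p ?N"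
      using \<open>X * R = Y * S\<close> eq_iff[OF X Y] mult_E[OF Z] by simp
    then have "\<delta> \<cdot>\<^sub>m ?Z = (?Z * L) * M"
      using minus_mat_eq_0_iff[of "\<delta> \<cdot>\<^sub>m ?Z" p ?N "(?Z * L) * M"] Z L M by simp
    then obtain U where U: "U \<in> carrier_mat p d" "?Z = U * M"
      using controllable_imp_row_space_saturated[OF M _ Z mult_carrier_mat[OF Z L] \<delta>]
        contr behaviour_eq_kernel_traj[OF A B] by (auto simp: M_def)
    have "copairing X (- Y) = copairing (U * A) (- (U * B))"
      using U A B by (simp add: M_def mult_copairing[of U p d A m "- B" n])
    then have "X = U * A" "- Y = - (U * B)"
      using copairing_eq_iff[of X p m "- Y" n "U * A" "- (U * B)"] X Y U A B by auto
    then have UXY: "U * A = X" "U * B = Y" by (auto dest: arg_cong[of _ _ uminus])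
    then show "\<exists>!U. U \<in> carrier_mat p d \<and> U * A = X \<and> U * B = Y"
      using U(1) by (intro ex1I[of _ U] conjI) (auto intro: corelation_epiD[OF AB])
  qed
  then show ?thesis using R S by blast
qed

theorem theorem6p4:
  fixes A B :: "'k::field laurent_poly mat" and m d n :: nat
  assumes "corelation m d n A B"
  shows "controllable (behaviour m n A B) \<longleftrightarrow>
    (\<exists>e. \<exists>R \<in> mat_hom e m. \<exists>S \<in> mat_hom e n.
       span_corel m e n R S = corel_class m n A B)"
  using controllable_imp_pushout[OF assms] pushout_imp_controllable
    span_corel_eq_corel_class_iff[OF assms] by metis

end
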